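(* Let $I\subset\mathbb{R}$ be an open interval and let $\gamma:I\to\mathbb{L}^3$ be a real analytic spacelike curve with non-zero curvature vector. If $\gamma$ is planar (its image is included in an affine plane of $\mathbb{L}^3$), then $\gamma$ is either a spacelike Frenet curve whose torsion function vanishes identically, or a spacelike curve of type $L$.
   Context: $\mathbb{L}^3$ is $\mathbb{R}^3$ with the inner product $\langle \boldsymbol{x},\boldsymbol{x}\rangle=x^2+y^2-z^2$ for $\boldsymbol{x}=(x,y,z)^T$. A vector $\boldsymbol{x}$ is spacelike if $\langle\boldsymbol{x},\boldsymbol{x}\rangle>0$ or $\boldsymbol{x}=\boldsymbol{0}$, timelike if $\langle\boldsymbol{x},\boldsymbol{x}\rangle<0$, and lightlike if $\boldsymbol{x}\neq\boldsymbol{0}$ and $\langle\boldsymbol{x},\boldsymbol{x}\rangle=0$. The vector product is $\boldsymbol{v}\times\boldsymbol{w}:=Z(\boldsymbol{v}\times_{\mathrm e}\boldsymbol{w})$, where $Z=\mathrm{diag}(1,1,-1)$ and $\times_{\mathrm e}$ is the standard Euclidean cross product. A regular curve is spacelike if each of its tangent vectors is spacelike. The following notions are defined with respect to an arclength parameter $s$ ($\langle\gamma',\gamma'\rangle=1$, prime $=d/ds$). Set $\boldsymbol{e}:=\gamma'$, $\boldsymbol{\kappa}:=\gamma''$ (curvature vector field), $\theta:=\langle\boldsymbol{\kappa},\boldsymbol{\kappa}\rangle$. The curve has non-zero curvature vector if $\boldsymbol{\kappa}$ vanishes nowhere (equivalently, in an arbitrary parameter $t$, $\dot\gamma(t)$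 and $\ddot\gamma(t)$ are linearly independent for every $t$). A curve with non-zero curvature vector is a spacelike Frenet curve if $\boldsymbol{\kappa}(s)$ is not lightlike for every $s\in I$; it is of type $L$ if $\boldsymbol{\kappa}(s)$ is lightlike for every $s\in I$. For a spacelike Frenet curve, put $\kappa:=\sqrt{|\theta|}$, $\sigma_\gamma:=-1$ if $\theta>0$ and $\sigma_\gamma:=+1$ if $\theta<0$, $\boldsymbol{n}:=\boldsymbol{\kappa}/\kappa$, $\boldsymbol{b}:=\sigma_\gamma\,\boldsymbol{e}\times\boldsymbol{n}$; the torsion function is $\tau:=\langle\boldsymbol{n}',\boldsymbol{b}\rangle$. *)

theory Defs
  imports "HOL-Analysis.Analysis"
begin

unbundle cross3_syntax

section \<open>Lorentz-Minkowski 3-space\<close>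

definition lorentz_inner :: "real^3 \<Rightarrow> real^3 \<Rightarrow> real" where
  "lorentz_inner v w = v $ 1 * w $ 1 + v $ 2 * w $ 2 - v $ 3 * w $ 3"

definition spacelike :: "real^3 \<Rightarrow> bool" where
  "spacelike v \<longleftrightarrow> lorentz_inner v v > 0 \<or> v = 0"

definition lightlike :: "real^3 \<Rightarrow> bool" where
  "lightlike v \<longleftrightarrow> v \<noteq> 0 \<and> lorentz_inner v v = 0"

definition Z_matrix :: "real^3^3" where
  "Z_matrix = vector [vector [1, 0, 0], vector [0, 1, 0], vector [0, 0, -1]]"

definition lorentz_cross :: "real^3 \<Rightarrow> real^3 \<Rightarrow> real^3" where
  "lorentz_cross v w = Z_matrix *v (v \<times> w)"

section \<open>Curves\<close>

text \<open>A curve is a function on all of the reals of which only the values on an open interval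
  \<open>I\<close> matter; since \<open>I\<close> is open, its derivatives at points of \<open>I\<close> depend only on these values.\<close>

definition real_analytic_on :: "(real \<Rightarrow> real^3) \<Rightarrow> real set \<Rightarrow> bool" where
  "real_analytic_on f I \<longleftrightarrow>
     (\<forall>t0\<in>I. \<exists>a. \<exists>r>0. \<forall>t. \<bar>t - t0\<bar> < r \<longrightarrow> (\<lambda>n. (t - t0) ^ n *\<^sub>R a n) sums f t)"

definition velocity :: "(real \<Rightarrow> real^3) \<Rightarrow> real \<Rightarrow> real^3" where
  "velocity \<gamma> t = vector_derivative \<gamma> (at t)"

definition regular_curve :: "(real \<Rightarrow> real^3) \<Rightarrow> real set \<Rightarrow> bool" where
  "regular_curve \<gamma> I \<longleftrightarrow> (\<forall>t\<in>I. \<gamma> differentiable at t \<and> velocity \<gamma> t \<noteq> 0)"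

definition spacelike_curve :: "(real \<Rightarrow> real^3) \<Rightarrow> real set \<Rightarrow> bool" where
  "spacelike_curve \<gamma> I \<longleftrightarrow> regular_curve \<gamma> I \<and> (\<forall>t\<in>I. spacelike (velocity \<gamma> t))"

definition planar_curve :: "(real \<Rightarrow> real^3) \<Rightarrow> real set \<Rightarrow> bool" where
  "planar_curve \<gamma> I \<longleftrightarrow> (\<exists>P. affine P \<and> aff_dim P = 2 \<and> \<gamma> ` I \<subseteq> P)"

section \<open>Differentiation by arclength\<close>

definition speed :: "(real \<Rightarrow> real^3) \<Rightarrow> real \<Rightarrow> real" where
  "speed \<gamma> t = sqrt (lorentz_inner (velocity \<gamma> t) (velocity \<gamma> t))"

text \<open>The curve \<open>\<gamma>\<close> is given in an arbitrary regular parameter \<open>t\<close>, and \<open>arc_deriv \<gamma> f\<close> is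
  the derivative \<open>df/ds\<close> by an arclength parameter \<open>s\<close> of \<open>\<gamma>\<close>, as a function of \<open>t\<close>, where
  \<open>ds/dt = speed \<gamma> t\<close>. The two lemmas below confirm this reading: if \<open>\<gamma>\<close> itself has unit speed
  it is the ordinary derivative, and in general it is the ordinary derivative of \<open>f \<circ> \<phi>\<close> whenever
  \<open>\<gamma> \<circ> \<phi>\<close> is a reparametrization of \<open>\<gamma>\<close> by arclength.\<close>

definition arc_deriv :: "(real \<Rightarrow> real^3) \<Rightarrow> (real \<Rightarrow> real^3) \<Rightarrow> real \<Rightarrow> real^3" where
  "arc_deriv \<gamma> f t = (1 / speed \<gamma> t) *\<^sub>R vector_derivative f (at t)"

lemma arc_deriv_unit_speed:
  assumes "lorentz_inner (velocity \<gamma> t) (velocity \<gamma> t) = 1"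
  shows "arc_deriv \<gamma> f t = vector_derivative f (at t)"
  using assms by (simp add: arc_deriv_def speed_def)

lemma arc_deriv_reparametrization:
  assumes \<phi>: "(\<phi> has_real_derivative d) (at s)" "d > 0"
    and \<gamma>: "\<gamma> differentiable at (\<phi> s)"
    and unit: "lorentz_inner (velocity (\<gamma> \<circ> \<phi>) s) (velocity (\<gamma> \<circ> \<phi>) s) = 1"
    and f: "f differentiable at (\<phi> s)"
  shows "arc_deriv \<gamma> f (\<phi> s) = vector_derivative (f \<circ> \<phi>) (at s)"
proof -
  have chain: "vector_derivative (g \<circ> \<phi>) (at s) = d *\<^sub>R vector_derivative g (at (\<phi> s))"
    if "g differentiable at (\<phi> s)" for g :: "real \<Rightarrow> real^3"
  proof (rule vector_derivative_at, rule vector_diff_chain_at)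
    show "(\<phi> has_vector_derivative d) (at s)"
      using \<phi>(1) by (simp add: has_real_derivative_iff_has_vector_derivative)
    show "(g has_vector_derivative vector_derivative g (at (\<phi> s))) (at (\<phi> s))"
      using that by (simp add: vector_derivative_works)
  qed
  have "d\<^sup>2 * lorentz_inner (velocity \<gamma> (\<phi> s)) (velocity \<gamma> (\<phi> s)) = 1"
    using unit chain[OF \<gamma>]
    by (simp add: velocity_def lorentz_inner_def power2_eq_square algebra_simps)
  hence "lorentz_inner (velocity \<gamma> (\<phi> s)) (velocity \<gamma> (\<phi> s)) = (1 / d)\<^sup>2"
    using \<phi>(2) by (simp add: field_simps)
  hence "speed \<gamma> (\<phi> s) = 1 / d"
    using \<phi>(2) by (simp add: speed_def)
  thus ?thesis
    using chain[OF f] by (simp add: arc_deriv_def)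
qed

section \<open>Frenet curves, curves of type L, torsion\<close>

definition unit_tangent :: "(real \<Rightarrow> real^3) \<Rightarrow> real \<Rightarrow> real^3" where
  "unit_tangent \<gamma> = arc_deriv \<gamma> \<gamma>"

definition curvature_vector :: "(real \<Rightarrow> real^3) \<Rightarrow> real \<Rightarrow> real^3" where
  "curvature_vector \<gamma> = arc_deriv \<gamma> (arc_deriv \<gamma> \<gamma>)"

definition curv_theta :: "(real \<Rightarrow> real^3) \<Rightarrow> real \<Rightarrow> real" where
  "curv_theta \<gamma> t = lorentz_inner (curvature_vector \<gamma> t) (curvature_vector \<gamma> t)"

definition nonzero_curvature_vector :: "(real \<Rightarrow> real^3) \<Rightarrow> real set \<Rightarrow> bool" where
  "nonzero_curvature_vector \<gamma> I \<longleftrightarrow> (\<forall>t\<in>I. curvature_vector \<gamma> t \<noteq> 0)"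

definition spacelike_frenet_curve :: "(real \<Rightarrow> real^3) \<Rightarrow> real set \<Rightarrow> bool" where
  "spacelike_frenet_curve \<gamma> I \<longleftrightarrow>
     spacelike_curve \<gamma> I \<and> nonzero_curvature_vector \<gamma> I \<and>
     (\<forall>t\<in>I. \<not> lightlike (curvature_vector \<gamma> t))"

definition spacelike_curve_of_type_L :: "(real \<Rightarrow> real^3) \<Rightarrow> real set \<Rightarrow> bool" where
  "spacelike_curve_of_type_L \<gamma> I \<longleftrightarrow>
     spacelike_curve \<gamma> I \<and> nonzero_curvature_vector \<gamma> I \<and>
     (\<forall>t\<in>I. lightlike (curvature_vector \<gamma> t))"

text \<open>The following are meaningful only where \<open>curv_theta \<gamma> t \<noteq> 0\<close>, hence on Frenet curves;
  there, the second branch of \<open>curv_sigma\<close> is the case \<open>curv_theta \<gamma> t < 0\<close>.\<close>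

definition curvature :: "(real \<Rightarrow> real^3) \<Rightarrow> real \<Rightarrow> real" where
  "curvature \<gamma> t = sqrt \<bar>curv_theta \<gamma> t\<bar>"

definition curv_sigma :: "(real \<Rightarrow> real^3) \<Rightarrow> real \<Rightarrow> real" where
  "curv_sigma \<gamma> t = (if curv_theta \<gamma> t > 0 then -1 else 1)"

definition principal_normal :: "(real \<Rightarrow> real^3) \<Rightarrow> real \<Rightarrow> real^3" where
  "principal_normal \<gamma> t = (1 / curvature \<gamma> t) *\<^sub>R curvature_vector \<gamma> t"

definition binormal :: "(real \<Rightarrow> real^3) \<Rightarrow> real \<Rightarrow> real^3" where
  "binormal \<gamma> t = curv_sigma \<gamma> t *\<^sub>R lorentz_cross (unit_tangent \<gamma> t) (principal_normal \<gamma> t)"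

definition torsion :: "(real \<Rightarrow> real^3) \<Rightarrow> real \<Rightarrow> real" where
  "torsion \<gamma> t = lorentz_inner (arc_deriv \<gamma> (principal_normal \<gamma>) t) (binormal \<gamma> t)"

end

theory Submission
  imports Defs
begin

text \<open>
  Let \<open>m\<close> be a Euclidean normal vector of the plane that contains the curve. Since
  \<open>m \<bullet> \<gamma>\<close> is constant, the unit tangent \<open>e\<close>, the curvature vector \<open>k\<close> and every derivative
  of a field that stays in the linear plane \<open>m \<bullet> x = 0\<close> lie in this linear plane again. In it
  the Euclidean cross product of any two vectors is a multiple of \<open>m\<close>, and this
  decides both questions.

  \<^item> The causal character of \<open>k\<close> is that of the plane. As \<open>e\<close> has
  constant length one, \<open>k\<close> is Lorentz-orthogonal to \<open>e\<close>, so the Gram identity reads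
  \<open>\<theta> = - \<langle>k \<times> e, k \<times> e\<rangle>\<close>. Here \<open>k \<times> e = \<mu> m\<close>, where \<open>\<mu> \<noteq> 0\<close> because \<open>k\<close> is not
  zero, whence \<open>\<theta> = - \<mu>\<^sup>2 \<langle>m, m\<rangle>\<close> (\<open>lorentz_square_in_plane\<close>). Thus \<open>\<theta>\<close>
  vanishes either everywhere, if the plane is degenerate (\<open>\<langle>m, m\<rangle> = 0\<close>), which is type
  \<open>L\<close>, or nowhere, which is the Frenet case (\<open>curv_theta_eq_0_iff\<close>).

  \<^item> The torsion is a multiple of the Euclidean determinant
  \<open>n' \<bullet> (e \<times> n)\<close>, since the reflection in the Lorentzian cross product cancels the one in the
  inner product. All three vectors lie in one plane, so it is zero (\<open>torsion_zero\<close>).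

  The vectors \<open>k\<close> and \<open>n\<close> involve second derivatives of \<open>\<gamma>\<close>, and the derivative of \<open>n\<close> a third
  one. Analyticity supplies these: the velocity of a real analytic
  curve is again real analytic (\<open>real_analytic_on_velocity\<close>).
\<close>

section \<open>Lorentzian algebra\<close>

lemma bounded_bilinear_lorentz_inner: "bounded_bilinear lorentz_inner"
  unfolding bilinear_conv_bounded_bilinear[symmetric] bilinear_def
  by (auto intro!: linearI simp: lorentz_inner_def algebra_simps)

text \<open>The reflection \<open>Z\<close> occurs once in the inner product and once in the cross product, and
  \<open>Z\<close> is an involution. Hence the Lorentzian triple product is the Euclidean determinant.\<close>

lemma lorentz_inner_lorentz_cross: "lorentz_inner u (lorentz_cross v w) = u \<bullet> (v \<times> w)"
  by (simp add: lorentz_inner_def lorentz_cross_def Z_matrix_def matrix_vector_mult_def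
      sum_3 inner_vec_def)

text \<open>The Lorentzian form of Lagrange's identity. The sign is opposite to the Euclidean one because
  \<open>Z\<close> has determinant \<open>-1\<close>. As \<open>Z\<close> is a Lorentzian isometry, the right-hand side may use the
  Euclidean cross product.\<close>

lemma lorentz_gram_identity:
  "lorentz_inner v v * lorentz_inner w w - (lorentz_inner v w)\<^sup>2
   = - lorentz_inner (v \<times> w) (v \<times> w)"
  by (simp add: lorentz_inner_def cross_components power2_eq_square algebra_simps)

lemma cross_parallel_normal:
  fixes m v w :: "real^3"
  assumes "m \<noteq> 0" "m \<bullet> v = 0" "m \<bullet> w = 0"
  obtains \<mu> where "v \<times> w = \<mu> *\<^sub>R m"
proof -
  have "m \<times> (v \<times> w) = (m \<bullet> w) *\<^sub>R v - (m \<bullet> v) *\<^sub>R w"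
    by (simp add: Lagrange)
  hence "m \<times> (v \<times> w) = 0"
    using assms by simp
  hence "v \<times> w = 0 \<or> (\<exists>\<mu>. v \<times> w = \<mu> *\<^sub>R m)"
    using \<open>m \<noteq> 0\<close> by (simp add: cross_eq_0[of m] collinear_lemma)
  thus ?thesis
    using that by (metis scaleR_zero_left)
qed

text \<open>The line of the plane \<open>m \<bullet> x = 0\<close> that is orthogonal to a unit spacelike vector \<open>e\<close> of the plane
  has a causal character that only depends on \<open>m\<close>. The factor \<open>\<mu>\<close> is nonzero since \<open>k\<close> and \<open>e\<close>
  are linearly independent: a multiple of \<open>e\<close> that is orthogonal to \<open>e\<close> vanishes.\<close>

lemma lorentz_square_in_plane:
  assumes "m \<noteq> 0" "m \<bullet> e = 0" "m \<bullet> k = 0"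
    and "lorentz_inner e e = 1" "lorentz_inner k e = 0" "k \<noteq> 0"
  obtains \<mu> where "\<mu> \<noteq> 0" "lorentz_inner k k = - (\<mu>\<^sup>2 * lorentz_inner m m)"
proof -
  interpret bounded_bilinear lorentz_inner by (rule bounded_bilinear_lorentz_inner)
  obtain \<mu> where \<mu>: "k \<times> e = \<mu> *\<^sub>R m"
    using cross_parallel_normal assms by metis
  have "lorentz_inner k k = - lorentz_inner (k \<times> e) (k \<times> e)"
    using lorentz_gram_identity[of k e] assms by simp
  also have "\<dots> = - (\<mu>\<^sup>2 * lorentz_inner m m)"
    by (simp add: \<mu> scaleR_left scaleR_right power2_eq_square)
  finally have eq: "lorentz_inner k k = - (\<mu>\<^sup>2 * lorentz_inner m m)" .
  have "e \<noteq> 0"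
    using assms(4) by (auto simp: zero_left)
  have "\<mu> \<noteq> 0"
  proof
    assume "\<mu> = 0"
    hence "e \<times> k = 0"
      using \<mu> cross_skew[of k e] by simp
    then obtain c where "k = c *\<^sub>R e"
      using \<open>e \<noteq> 0\<close> \<open>k \<noteq> 0\<close> unfolding cross_eq_0 collinear_lemma by auto
    with assms show False by (simp add: scaleR_left)
  qed
  with eq that show ?thesis by blast
qed

section \<open>Derivatives of real analytic curves\<close>

text \<open>Termwise differentiation, centred at \<open>t0\<close>, and with the derivative series attached, so that
  the step can be iterated.\<close>

lemma powser_sums_has_real_derivative:
  fixes f :: "real \<Rightarrow> real"
  assumes "\<And>t. \<bar>t - t0\<bar> < r \<Longrightarrow> (\<lambda>n. c n * (t - t0) ^ n) sums f t"
    and "\<bar>t - t0\<bar> < r"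
  shows "\<exists>D. (f has_real_derivative D) (at t) \<and> (\<lambda>n. diffs c n * (t - t0) ^ n) sums D"
proof -
  define g where "g x = f (x + t0)" for x
  have g: "(\<lambda>n. c n * x ^ n) sums g x" if "norm x < r" for x
    using assms(1)[of "x + t0"] that by (simp add: g_def)
  have "((\<lambda>x. \<Sum>n. c n * x ^ n) has_real_derivative (\<Sum>n. diffs c n * (t - t0) ^ n)) (at (t - t0))"
    by (rule termdiffs_strong'[of r]) (use g assms(2) in \<open>auto simp: sums_iff\<close>)
  hence D: "(g has_real_derivative (\<Sum>n. diffs c n * (t - t0) ^ n)) (at (t - t0))"
  proof (rule has_field_derivative_transform_within_open)
    show "open {-r<..<r}" "t - t0 \<in> {-r<..<r}"
      using assms(2) by auto
  next
    show "(\<Sum>n. c n * x ^ n) = g x" if "x \<in> {-r<..<r}" for x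
      using g[of x] that by (simp add: sums_iff abs_less_iff)
  qed
  have "(f has_real_derivative (\<Sum>n. diffs c n * (t - t0) ^ n)) (at t)"
    using D DERIV_shift[of f _ "t - t0" t0] by (simp add: g_def[abs_def] add.commute)
  moreover have "(\<lambda>n. diffs c n * (t - t0) ^ n) sums (\<Sum>n. diffs c n * (t - t0) ^ n)"
    by (rule termdiffs_sums_strong[OF g D]) (use assms(2) in auto)
  ultimately show ?thesis by blast
qed

lemma has_vector_derivative_vec:
  fixes f :: "real \<Rightarrow> real^'n"
  assumes "\<And>i. ((\<lambda>t. f t $ i) has_real_derivative D $ i) (at t)"
  shows "(f has_vector_derivative D) (at t)"
  unfolding has_vector_derivative_def
proof (subst has_derivative_componentwise_within, intro ballI)
  fix b :: "real^'n" assume "b \<in> Basis"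
  then obtain i where "b = axis i 1" by (auto simp: Basis_vec_def)
  with assms[of i]
  show "((\<lambda>x. f x \<bullet> b) has_derivative (\<lambda>x. x *\<^sub>R D \<bullet> b)) (at t)"
    by (simp add: inner_axis has_field_derivative_def mult_commute_abs)
qed

lemma sums_vec:
  fixes D :: "real^'n"
  assumes "\<And>i. (\<lambda>n. f n $ i) sums (D $ i)"
  shows "f sums D"
  unfolding sums_def by (rule vec_tendstoI) (use assms in \<open>simp add: sums_def\<close>)

text \<open>Termwise differentiation applies to each coordinate. The derivative series converges on the
  same interval as the given one, so one radius serves both. Iteration gives derivatives of all
  orders.\<close>

lemma real_analytic_on_velocity:
  assumes "real_analytic_on f I"
  shows "real_analytic_on (velocity f) I"
    and "\<And>t. t \<in> I \<Longrightarrow> (f has_vector_derivative velocity f t) (at t)"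
proof -
  have *: "\<exists>a. \<exists>r>0. \<forall>t. \<bar>t - t0\<bar> < r \<longrightarrow>
      (f has_vector_derivative velocity f t) (at t) \<and>
      (\<lambda>n. (t - t0) ^ n *\<^sub>R a n) sums velocity f t" if "t0 \<in> I" for t0
  proof -
    obtain a r where "r > 0"
      and a: "\<And>t. \<bar>t - t0\<bar> < r \<Longrightarrow> (\<lambda>n. (t - t0) ^ n *\<^sub>R a n) sums f t"
      using bspec[OF assms[unfolded real_analytic_on_def] \<open>t0 \<in> I\<close>] by blast
    define a' where "a' n = (\<chi> i. diffs (\<lambda>n. a n $ i) n)" for n
    have "(f has_vector_derivative velocity f t) (at t) \<and>
          (\<lambda>n. (t - t0) ^ n *\<^sub>R a' n) sums velocity f t" if t: "\<bar>t - t0\<bar> < r" for t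
    proof -
      have "\<exists>d. ((\<lambda>t. f t $ i) has_real_derivative d) (at t) \<and>
                (\<lambda>n. diffs (\<lambda>n. a n $ i) n * (t - t0) ^ n) sums d" for i
      proof (rule powser_sums_has_real_derivative[OF _ t])
        fix s assume "\<bar>s - t0\<bar> < r"
        from sums_vec_nth[OF a[OF this], of i]
        show "(\<lambda>n. a n $ i * (s - t0) ^ n) sums (f s $ i)"
          by (simp add: mult.commute)
      qed
      then obtain d where d: "\<And>i. ((\<lambda>t. f t $ i) has_real_derivative d i) (at t)"
          "\<And>i. (\<lambda>n. diffs (\<lambda>n. a n $ i) n * (t - t0) ^ n) sums d i"
        by metis
      have D: "(f has_vector_derivative (\<chi> i. d i)) (at t)"
        by (rule has_vector_derivative_vec) (simp add: d)
      have S: "(\<lambda>n. (t - t0) ^ n *\<^sub>R a' n) sums (\<chi> i. d i)"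
        by (rule sums_vec) (use d(2) in \<open>simp add: a'_def mult.commute\<close>)
      from D have "velocity f t = (\<chi> i. d i)"
        by (simp add: velocity_def vector_derivative_at)
      with D S show ?thesis by simp
    qed
    with \<open>r > 0\<close> show ?thesis by blast
  qed
  show "real_analytic_on (velocity f) I"
    unfolding real_analytic_on_def using * by blast
  show "(f has_vector_derivative velocity f t) (at t)" if "t \<in> I" for t
    using *[OF that] by force
qed

lemma bounded_linear_const_imp_derivative_zero:
  assumes "bounded_linear h" "open I" "t \<in> I" "\<And>s. s \<in> I \<Longrightarrow> h (f s) = c"
    and "(f has_vector_derivative f') (at t)"
  shows "h f' = 0"
proof -
  have "((\<lambda>s. h (f s)) has_vector_derivative h f') (at t)"
    by (rule bounded_linear.has_vector_derivative[OF assms(1,5)])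
  moreover have "((\<lambda>s. h (f s)) has_vector_derivative 0) (at t)"
    by (rule has_vector_derivative_transform_within_open[of "\<lambda>_. c" _ _ I])
       (use assms in auto)
  ultimately show ?thesis by (rule vector_derivative_unique_at)
qed

section \<open>The curvature vector\<close>

text \<open>The letters are \<open>v\<close> and \<open>a\<close> for velocity and acceleration in the given parameter,
  and \<open>e\<close> and \<open>k\<close> for unit tangent and curvature vector, which are the derivatives by
  arclength.\<close>

locale analytic_spacelike_curve =
  fixes \<gamma> :: "real \<Rightarrow> real^3" and I :: "real set"
  assumes open_I: "open I"
    and analytic: "real_analytic_on \<gamma> I"
    and spacelike_curve: "spacelike_curve \<gamma> I"
begin

abbreviation "v \<equiv> velocity \<gamma>"
abbreviation "a \<equiv> velocity v"
abbreviation "e \<equiv> unit_tangent \<gamma>"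
abbreviation "k \<equiv> curvature_vector \<gamma>"

sublocale lorentz: bounded_bilinear lorentz_inner
  by (rule bounded_bilinear_lorentz_inner)

lemma velocity_pos: "t \<in> I \<Longrightarrow> lorentz_inner (v t) (v t) > 0"
  using spacelike_curve
  by (auto simp: spacelike_curve_def regular_curve_def spacelike_def)

lemma speed_pos: "t \<in> I \<Longrightarrow> speed \<gamma> t > 0"
  by (simp add: speed_def velocity_pos)

lemma derivatives:
  assumes "t \<in> I"
  shows "(\<gamma> has_vector_derivative v t) (at t)"
    "(v has_vector_derivative a t) (at t)"
    "(a has_vector_derivative velocity a t) (at t)"
  using assms real_analytic_on_velocity(2)[OF analytic]
    real_analytic_on_velocity(2)[OF real_analytic_on_velocity(1)[OF analytic]]
    real_analytic_on_velocity(2)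
      [OF real_analytic_on_velocity(1)[OF real_analytic_on_velocity(1)[OF analytic]]]
  by simp_all

lemma unit_tangent_eq: "e t = (1 / speed \<gamma> t) *\<^sub>R v t"
  by (simp add: unit_tangent_def arc_deriv_def velocity_def)

lemma unit_tangent_unit: "t \<in> I \<Longrightarrow> lorentz_inner (e t) (e t) = 1"
  using velocity_pos[of t]
  by (simp add: unit_tangent_eq lorentz.scaleR_left lorentz.scaleR_right speed_def)

lemma speed_derivative:
  assumes "t \<in> I"
  shows "(speed \<gamma> has_real_derivative lorentz_inner (v t) (a t) / speed \<gamma> t) (at t)"
proof -
  let ?q = "\<lambda>t. lorentz_inner (v t) (v t)"
  have "lorentz_inner x y = lorentz_inner y x" for x y
    by (simp add: lorentz_inner_def)
  with lorentz.has_vector_derivative[OF derivatives(2) derivatives(2), OF assms assms]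
  have "(?q has_real_derivative 2 * lorentz_inner (v t) (a t)) (at t)"
    by (simp add: has_real_derivative_iff_has_vector_derivative)
  hence "((\<lambda>t. sqrt (?q t)) has_real_derivative
      (inverse (sqrt (?q t)) / 2) * (2 * lorentz_inner (v t) (a t))) (at t)"
    by (rule DERIV_chain2[where f = sqrt and g = ?q, OF DERIV_real_sqrt[OF velocity_pos[OF assms]]])
  thus ?thesis
    by (simp add: speed_def[abs_def] field_simps)
qed

text \<open>The formula expresses \<open>k\<close> by derivatives in the given parameter, which makes its
  differentiability evident.\<close>

lemma unit_tangent_derivative:
  assumes "t \<in> I"
  shows "(e has_vector_derivative speed \<gamma> t *\<^sub>R k t) (at t)"
    and "k t = (1 / (speed \<gamma> t)\<^sup>2) *\<^sub>R a t
                - (lorentz_inner (v t) (a t) / (speed \<gamma> t)^4) *\<^sub>R v t"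
proof -
  let ?s = "speed \<gamma> t"
  have s: "?s > 0" using assms by (rule speed_pos)
  have "((\<lambda>t. 1 / speed \<gamma> t) has_real_derivative - (lorentz_inner (v t) (a t) / ?s^3)) (at t)"
    using speed_derivative[OF assms] s
    by (auto intro!: derivative_eq_intros simp: power3_eq_cube)
  from has_vector_derivative_scaleR[OF this derivatives(2)[OF assms]]
  have D: "(e has_vector_derivative
      (1 / ?s) *\<^sub>R a t - (lorentz_inner (v t) (a t) / ?s^3) *\<^sub>R v t) (at t)"
    by (simp add: unit_tangent_eq[abs_def])
  hence k: "k t = (1 / ?s) *\<^sub>R ((1 / ?s) *\<^sub>R a t - (lorentz_inner (v t) (a t) / ?s^3) *\<^sub>R v t)"
    unfolding curvature_vector_def arc_deriv_def[of _ "arc_deriv \<gamma> \<gamma>"] unit_tangent_def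
    by (simp add: vector_derivative_at)
  with D s show "(e has_vector_derivative ?s *\<^sub>R k t) (at t)"
    by simp
  show "k t = (1 / ?s\<^sup>2) *\<^sub>R a t - (lorentz_inner (v t) (a t) / ?s^4) *\<^sub>R v t"
    using s by (simp add: k scaleR_diff_right power2_eq_square power_numeral_reduce)
qed

lemma curvature_vector_differentiable:
  assumes "t \<in> I"
  obtains k' where "(k has_vector_derivative k') (at t)"
proof -
  note s = speed_derivative[OF assms] and s0 = speed_pos[OF assms]
  note d = derivatives[OF assms]
  have 1: "\<exists>D. ((\<lambda>t. 1 / (speed \<gamma> t)\<^sup>2) has_real_derivative D) (at t)"
    by (rule exI) (use s s0 in \<open>auto intro!: derivative_eq_intros\<close>)
  have "\<exists>D. ((\<lambda>t. lorentz_inner (v t) (a t)) has_real_derivative D) (at t)"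
    using lorentz.has_vector_derivative[OF d(2,3)]
    by (auto simp: has_real_derivative_iff_has_vector_derivative)
  then obtain p where p: "((\<lambda>t. lorentz_inner (v t) (a t)) has_real_derivative p) (at t)" ..
  have 2: "\<exists>D. ((\<lambda>t. lorentz_inner (v t) (a t) / (speed \<gamma> t)^4) has_real_derivative D) (at t)"
    by (rule exI) (rule derivative_eq_intros p s refl | use s0 in simp)+
  from 1 2 obtain D1 D2 where
    "((\<lambda>t. 1 / (speed \<gamma> t)\<^sup>2) has_real_derivative D1) (at t)"
    "((\<lambda>t. lorentz_inner (v t) (a t) / (speed \<gamma> t)^4) has_real_derivative D2) (at t)"
    by blast
  from has_vector_derivative_diff[OF has_vector_derivative_scaleR[OF this(1) d(3)]
      has_vector_derivative_scaleR[OF this(2) d(2)]]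
  show ?thesis
    by (intro that, rule has_vector_derivative_transform_within_open[OF _ open_I assms])
       (simp_all add: unit_tangent_derivative(2))
qed

text \<open>Differentiate \<open>\<langle>e, e\<rangle> = 1\<close>.\<close>

lemma curvature_vector_orthogonal:
  assumes "t \<in> I"
  shows "lorentz_inner (k t) (e t) = 0"
proof -
  note D = unit_tangent_derivative(1)[OF assms]
  have "lorentz_inner (e t) (speed \<gamma> t *\<^sub>R k t) + lorentz_inner (speed \<gamma> t *\<^sub>R k t) (e t) = 0"
  proof (rule vector_derivative_unique_at)
    show "((\<lambda>t. lorentz_inner (e t) (e t)) has_vector_derivative
        lorentz_inner (e t) (speed \<gamma> t *\<^sub>R k t) + lorentz_inner (speed \<gamma> t *\<^sub>R k t) (e t)) (at t)"
      by (rule lorentz.has_vector_derivative[OF D D])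
    show "((\<lambda>t. lorentz_inner (e t) (e t)) has_vector_derivative 0) (at t)"
      by (rule has_vector_derivative_transform_within_open[OF _ open_I assms, of "\<lambda>_. 1"])
         (auto simp: unit_tangent_unit)
  qed
  moreover have "lorentz_inner (e t) (k t) = lorentz_inner (k t) (e t)"
    by (simp add: lorentz_inner_def)
  ultimately show ?thesis
    using speed_pos[OF assms] by (simp add: lorentz.scaleR_left lorentz.scaleR_right)
qed

text \<open>Where \<open>\<theta>\<close> is nonzero, so is \<open>\<kappa>\<close>, and dividing by it preserves differentiability.\<close>

lemma principal_normal_differentiable:
  assumes "t \<in> I" "curv_theta \<gamma> t \<noteq> 0"
  obtains n' where "(principal_normal \<gamma> has_vector_derivative n') (at t)"
proof -
  obtain k' where k': "(k has_vector_derivative k') (at t)"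
    using curvature_vector_differentiable assms by blast
  obtain \<theta>' where \<theta>': "(curv_theta \<gamma> has_real_derivative \<theta>') (at t)"
    using lorentz.has_vector_derivative[OF k' k']
    by (auto simp: has_real_derivative_iff_has_vector_derivative curv_theta_def[abs_def])
  \<comment> \<open>The absolute value is written as the root of a square, which has a derivative rule that
    covers both signs at once.\<close>
  have "\<exists>D. ((\<lambda>t. 1 / sqrt (sqrt ((curv_theta \<gamma> t)\<^sup>2))) has_real_derivative D) (at t)"
    by (rule exI) (rule derivative_eq_intros \<theta>' refl | use assms in simp)+
  then obtain c where "((\<lambda>t. 1 / curvature \<gamma> t) has_real_derivative c) (at t)"
    by (auto simp: curvature_def)
  from has_vector_derivative_scaleR[OF this k'] that show ?thesis
    by (simp add: principal_normal_def[abs_def])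
qed

end

section \<open>Planar curves\<close>

locale planar_spacelike_curve = analytic_spacelike_curve +
  fixes m :: "real^3" and c :: real
  assumes normal_nonzero: "m \<noteq> 0"
    and in_plane: "t \<in> I \<Longrightarrow> m \<bullet> \<gamma> t = c"
begin

lemma derivative_in_plane:
  assumes "t \<in> I" "\<And>s. s \<in> I \<Longrightarrow> m \<bullet> f s = b" "(f has_vector_derivative f') (at t)"
  shows "m \<bullet> f' = 0"
  using bounded_linear_const_imp_derivative_zero[OF bounded_linear_inner_right open_I] assms by blast

lemma unit_tangent_in_plane: "t \<in> I \<Longrightarrow> m \<bullet> e t = 0"
  using derivative_in_plane[OF _ in_plane derivatives(1)] by (simp add: unit_tangent_eq)

lemma curvature_vector_in_plane: "t \<in> I \<Longrightarrow> m \<bullet> k t = 0"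
  using derivative_in_plane[OF _ unit_tangent_in_plane unit_tangent_derivative(1)]
    speed_pos by fastforce

text \<open>The right-hand side does not depend on \<open>t\<close>: this makes \<open>k\<close> lightlike everywhere or
  nowhere.\<close>

lemma curv_theta_eq_0_iff:
  assumes "t \<in> I" "k t \<noteq> 0"
  shows "curv_theta \<gamma> t = 0 \<longleftrightarrow> lorentz_inner m m = 0"
proof -
  obtain \<mu> where "\<mu> \<noteq> 0" "curv_theta \<gamma> t = - (\<mu>\<^sup>2 * lorentz_inner m m)"
    unfolding curv_theta_def
    using lorentz_square_in_plane[of m "e t" "k t"] assms normal_nonzero unit_tangent_unit
      unit_tangent_in_plane curvature_vector_in_plane curvature_vector_orthogonal by metis
  thus ?thesis by simp
qed

text \<open>The field \<open>n\<close> stays in the plane, hence so does its derivative, and the torsion is a multiple of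
  the determinant of three coplanar vectors. Differentiability of \<open>n\<close> is essential here, because
  \<open>vector_derivative\<close> has an arbitrary value where no derivative exists.\<close>

lemma torsion_zero:
  assumes "t \<in> I" "curv_theta \<gamma> t \<noteq> 0"
  shows "torsion \<gamma> t = 0"
proof -
  let ?n = "principal_normal \<gamma>"
  have n: "m \<bullet> ?n s = 0" if "s \<in> I" for s
    using curvature_vector_in_plane[OF that] by (simp add: principal_normal_def)
  obtain n' where n': "(?n has_vector_derivative n') (at t)"
    using principal_normal_differentiable assms by blast
  have "m \<bullet> n' = 0"
    using derivative_in_plane[OF assms(1) n n'] .
  moreover obtain \<mu> where "e t \<times> ?n t = \<mu> *\<^sub>R m"
    using cross_parallel_normal normal_nonzero unit_tangent_in_plane n assms(1) by metis
  ultimately have "n' \<bullet> (e t \<times> ?n t) = 0"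
    by (simp add: inner_commute)
  thus ?thesis
    by (simp add: torsion_def binormal_def arc_deriv_def[of \<gamma> ?n] vector_derivative_at[OF n']
        lorentz.scaleR_left lorentz.scaleR_right lorentz_inner_lorentz_cross)
qed

end

theorem corollary3p11:
  fixes \<gamma> :: "real \<Rightarrow> real^3" and I :: "real set"
  assumes "open I" and "is_interval I" and "I \<noteq> {}"
    and "real_analytic_on \<gamma> I"
    and "spacelike_curve \<gamma> I"
    and "nonzero_curvature_vector \<gamma> I"
    and "planar_curve \<gamma> I"
  shows "(spacelike_frenet_curve \<gamma> I \<and> (\<forall>t\<in>I. torsion \<gamma> t = 0))
       \<or> spacelike_curve_of_type_L \<gamma> I"
proof -
  obtain P where P: "aff_dim P = 2" "\<gamma> ` I \<subseteq> P"
    using assms(7) unfolding planar_curve_def by blast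
  \<comment> \<open>A plane has dimension less than three, so it lies in a hyperplane; its normal is \<open>m\<close>.\<close>
  have "aff_dim P < int DIM(real^3)"
    using P by simp
  then obtain m c where "m \<noteq> 0" "P \<subseteq> {x. m \<bullet> x = c}"
    using aff_lowdim_subset_hyperplane by blast
  then interpret planar_spacelike_curve \<gamma> I m c
    using assms P by unfold_locales auto
  have k: "curvature_vector \<gamma> t \<noteq> 0" if "t \<in> I" for t
    using assms(6) that by (simp add: nonzero_curvature_vector_def)
  show ?thesis
  proof (cases "lorentz_inner m m = 0")
    case True
    hence "spacelike_curve_of_type_L \<gamma> I"
      using assms k curv_theta_eq_0_iff
      by (simp add: spacelike_curve_of_type_L_def lightlike_def curv_theta_def)
    thus ?thesis ..
  next
    case False
    hence "curv_theta \<gamma> t \<noteq> 0" if "t \<in> I" for t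
      using curv_theta_eq_0_iff k that by blast
    hence "spacelike_frenet_curve \<gamma> I \<and> (\<forall>t\<in>I. torsion \<gamma> t = 0)"
      using assms torsion_zero
      by (simp add: spacelike_frenet_curve_def lightlike_def curv_theta_def)
    thus ?thesis ..
  qed
qed

end
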